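(* For all $n\ge0$, $\mathrm{CO}_{2n+2}=h_n=G^{\mathrm{I}}_{2n}$.
   Context: A permutation $\pi$ of $[2m]$ is collapsed if $1+\lfloor k/2\rfloor\le\pi^{-1}(k)\le m+\lfloor k/2\rfloor$ for every $k\in[2m]$; $\mathrm{CO}_{2m}$ is the number of collapsed permutations of $[2m]$. $G^{\mathrm{I}}_{2n}$ is the number of permutations $\pi$ of $[2n]$ such that every ascent $\pi_i<\pi_{i+1}$ has $\pi_i$ odd and $\pi_{i+1}$ even (with $G^{\mathrm{I}}_0=1$, the empty permutation). The median Genocchi numbers are $h_n=S_{2n+2,1}$, where the Seidel triangle is given by $S_{1,1}=1$, $S_{n,k}=0$ if $k\notin[1,\lceil n/2\rceil]$, $S_{2n,k}=S_{2n-1,k}+S_{2n,k+1}$, $S_{2n+1,k}=S_{2n,k}+S_{2n+1,k-1}$; so $(h_n)_{n\ge0}=1,2,8,56,608,9440,\dots$. *)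

theory Defs
  imports Main "HOL-Combinatorics.Permutations"
begin

text \<open>
  A permutation of \<open>[N]\<close> is a function \<open>\<pi> :: nat \<Rightarrow> nat\<close> with \<open>\<pi> permutes {1..N}\<close>; its word is
  \<open>\<pi> 1, \<dots>, \<pi> N\<close>. Since such a \<open>\<pi>\<close> is the identity outside \<open>{1..N}\<close>, it is determined by its word.
\<close>

definition collapsed :: "nat \<Rightarrow> (nat \<Rightarrow> nat) \<Rightarrow> bool" where
  "collapsed m \<pi> \<longleftrightarrow> \<pi> permutes {1..2*m} \<and>
     (\<forall>k\<in>{1..2*m}. 1 + k div 2 \<le> inv \<pi> k \<and> inv \<pi> k \<le> m + k div 2)"

text \<open>\<open>num_collapsed m\<close> is \<open>CO\<^bsub>2m\<^esub>\<close>: the argument is half the size of the permutations.\<close>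

definition num_collapsed :: "nat \<Rightarrow> nat" where
  "num_collapsed m = card {\<pi>. collapsed m \<pi>}"

definition ascents_odd_even :: "nat \<Rightarrow> (nat \<Rightarrow> nat) \<Rightarrow> bool" where
  "ascents_odd_even N \<pi> \<longleftrightarrow>
     (\<forall>i\<in>{1..<N}. \<pi> i < \<pi> (i + 1) \<longrightarrow> odd (\<pi> i) \<and> even (\<pi> (i + 1)))"

text \<open>\<open>genocchi_I n\<close> is \<open>G\<^sup>I\<^bsub>2n\<^esub>\<close>: again the argument is half the size of the permutations.\<close>

definition genocchi_I :: "nat \<Rightarrow> nat" where
  "genocchi_I n = card {\<pi>. \<pi> permutes {1..2*n} \<and> ascents_odd_even (2*n) \<pi>}"

text \<open>
  The Seidel triangle. The first branch is the convention that entries with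
  \<open>k \<notin> [1, \<lceil>n/2\<rceil>]\<close> vanish, so that the two recurrences are applied only inside that range;
  even rows are filled from right to left, odd rows from left to right.
\<close>

function seidel :: "nat \<Rightarrow> nat \<Rightarrow> nat" where
  "seidel n k =
     (if k \<notin> {1..(n + 1) div 2} then 0
      else if n = 1 then 1
      else if even n then seidel (n - 1) k + seidel n (k + 1)
      else seidel (n - 1) k + seidel n (k - 1))"
  by pat_completeness auto
termination
  by (relation "measures [\<lambda>(n, k). n, \<lambda>(n, k). if even n then n + 1 - k else k]") auto

declare seidel.simps [simp del]

lemma seidel_1_1: "seidel 1 1 = 1"
  by (simp add: seidel.simps)

lemma seidel_outside: "k \<notin> {1..(n + 1) div 2} \<Longrightarrow> seidel n k = 0"
  by (simp add: seidel.simps)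

lemma seidel_even:
  assumes "1 \<le> k" "k \<le> n"
  shows "seidel (2 * n) k = seidel (2 * n - 1) k + seidel (2 * n) (k + 1)"
  using assms by (subst seidel.simps) auto

lemma seidel_odd:
  assumes "1 \<le> n" "1 \<le> k" "k \<le> n + 1"
  shows "seidel (2 * n + 1) k = seidel (2 * n) k + seidel (2 * n + 1) (k - 1)"
  using assms by (subst seidel.simps) auto

definition median_genocchi :: "nat \<Rightarrow> nat" where
  "median_genocchi n = seidel (2 * n + 2) 1"

lemma median_genocchi_initial:
  "map median_genocchi [0, 1, 2, 3, 4] = [1, 2, 8, 56, 608]"
  by (simp add: median_genocchi_def seidel.simps)

end

theory Submission
  imports Defs
begin

text \<open>
  All three numbers count Motzkin paths of length \<open>n\<close> from height 1 to height 1 in which a level step at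
  height \<open>t\<close> has weight \<open>2 t\<^sup>2\<close> and a step between \<open>t\<close> and \<open>t + 1\<close> has weight \<open>t (t + 1)\<close>.

  Seidel triangle: the weight \<open>W\<close> of such paths is given by the powers of \<open>J = \<theta> (1 + y)\<^sup>2 y\<^sup>-\<^sup>1 \<theta>\<close>, \<open>\<theta> = y d/dy\<close>,
  and \<open>(J + K (K + 1)) (1 + y)\<^sup>K = K (K + 1) (1 + y)\<^bsup>K+1\<^esup>\<close> up to constants, killed by \<open>\<theta>\<close>. Hence the functional
  with moments \<open>1, W\<^sub>0, W\<^sub>1, \<dots>\<close> takes the value \<open>k!\<^sup>2\<close> on \<open>\<Prod>j<k. (x + j (j + 1))\<close>. Solving the Seidel
  recurrences by polynomials in \<open>k\<close>, the only remaining condition is that the last entries vanish; it says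
  that the functional annihilates certain Fibonacci polynomials, whose coefficients in that product
  basis make the sum telescope.

  Collapsed permutations: scanning the rows and columns of the permutation matrix, the height is the
  number of rows waiting for a column.

  Permutations with ascents from odd to even: inserting the letters in increasing order, the height is
  the number of blocks of the partial word.
\<close>

subsection \<open>Weighted paths and the Seidel triangle\<close>

text \<open>The recursion is on the first step of a path from height \<open>t\<close> to height 1.
  The factor \<open>t * (t - 1)\<close> is 0 for \<open>t \<le> 1\<close>, so no path from a
  positive height reaches 0.\<close>

fun path_weight :: "nat \<Rightarrow> nat \<Rightarrow> nat" where
  "path_weight 0 t = (if t = 1 then 1 else 0)"
| "path_weight (Suc n) t = 2 * t\<^sup>2 * path_weight n t + t * (t - 1) * path_weight n (t - 1)
     + t * (t + 1) * path_weight n (t + 1)"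

text \<open>With \<open>J\<close> the one-step operator of \<open>path_weight\<close>, this is J^i
  times the product of J + j (j + 1) over j = 1..k, applied to the indicator of height 1.\<close>

fun newton_path :: "nat \<Rightarrow> nat \<Rightarrow> nat \<Rightarrow> nat" where
  "newton_path 0 i t = path_weight i t"
| "newton_path (Suc k) i t = newton_path k (Suc i) t + (k + 1) * (k + 2) * newton_path k i t"

lemma newton_path_Suc:
  "newton_path k (Suc i) t = 2 * t\<^sup>2 * newton_path k i t + t * (t - 1) * newton_path k i (t - 1)
     + t * (t + 1) * newton_path k i (t + 1)"
proof (induction k arbitrary: i)
  case (Suc k)
  show ?case
    unfolding newton_path.simps Suc.IH[of "Suc i"]
    by (subst Suc.IH[of i]) (simp only: distrib_left distrib_right mult.assoc mult.left_commute add.assoc add.left_commute add.commute)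
qed simp

text \<open>The coefficient of y^t in the identity for \<open>J\<close> and (1 + y)^K; absorption
  relates the three neighbouring binomials.\<close>

lemma binomial_path_step:
  assumes "1 \<le> t"
  shows "2 * t\<^sup>2 * (K choose t) + t * (t - 1) * (K choose (t - 1)) + t * (t + 1) * (K choose (t + 1))
     + K * (K + 1) * (K choose t) = K * (K + 1) * (Suc K choose t)"
proof -
  obtain s where t: "t = Suc s" using assms by (cases t) auto
  define a b c where "a = int (K choose t)" and "b = int (K choose s)" and "c = int (K choose (t + 1))"
  have absorb: "int (Suc j) * int (K choose Suc j) = (int K - int j) * int (K choose j)" for j
  proof (cases "j \<le> K")
    case True
    have "Suc j * (K choose Suc j) = (K choose j) * (K - j)"
      by (metis binomial_absorption binomial_absorb_comp mult.commute)
    then show ?thesis using True by (metis of_nat_diff of_nat_mult mult.commute)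
  qed (simp add: binomial_eq_0)
  have 1: "(int t + 1) * c = (int K - int t) * a"
    using absorb[of t] by (simp add: a_def c_def algebra_simps)
  have 2: "int t * a = (int K - int t + 1) * b"
    using absorb[of s] by (simp add: a_def b_def t algebra_simps)
  have "int t * (int t + 1) * c = int t * ((int K - int t) * a)"
    by (simp only: mult.assoc 1)
  \<comment> \<open>Once \<open>c\<close> is eliminated, the claim is t a = (K - t + 1) b multiplied
    by t + K, because K (K + 1) - t (t - 1) = (K + t) (K - t + 1).\<close>
  moreover have "(int t + int K) * (int t * a) = (int t + int K) * ((int K - int t + 1) * b)"
    using 2 by simp
  ultimately have "2 * (int t)\<^sup>2 * a + int t * (int t - 1) * b + int t * (int t + 1) * c
      + int K * (int K + 1) * a = int K * (int K + 1) * (a + b)"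
    by (simp add: algebra_simps power2_eq_square)
  then have "int (2 * t\<^sup>2 * (K choose t) + t * (t - 1) * (K choose (t - 1)) + t * (t + 1) * (K choose (t + 1))
     + K * (K + 1) * (K choose t)) = int (K * (K + 1) * (Suc K choose t))"
    by (simp add: a_def b_def c_def t algebra_simps)
  then show ?thesis by (simp only: of_nat_eq_iff)
qed

text \<open>At positive heights the indicator of height 1 agrees with 1 + y, and each new factor is
  the one that \<open>binomial_path_step\<close> needs for K = k + 1. The constants K (K + 1)
  multiply up to k! (k + 1)!.\<close>

lemma newton_path_0:
  "1 \<le> t \<Longrightarrow> newton_path k 0 t = fact k * fact (Suc k) * (Suc k choose t)"
proof (induction k arbitrary: t)
  case 0
  then show ?case by (cases t; cases "t - 1") (auto simp: binomial_eq_0)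
next
  case (Suc k)
  let ?f = "fact k * fact (Suc k) :: nat"
  \<comment> \<open>The induction hypothesis says nothing about height 0; for \<open>t = 1\<close>
    the factor \<open>t - 1\<close> removes that term.\<close>
  have pred: "t * (t - 1) * newton_path k 0 (t - 1) = t * (t - 1) * (?f * (Suc k choose (t - 1)))"
  proof (cases "t = 1")
    case False
    then have "1 \<le> t - 1" using Suc.prems by linarith
    then show ?thesis by (simp only: Suc.IH)
  qed simp
  have "newton_path (Suc k) 0 t = ?f * (2 * t\<^sup>2 * (Suc k choose t)
      + t * (t - 1) * (Suc k choose (t - 1)) + t * (t + 1) * (Suc k choose (t + 1))
      + Suc k * (Suc k + 1) * (Suc k choose t))"
    using Suc.prems
    by (simp only: newton_path.simps newton_path_Suc pred Suc.IH[OF Suc.prems] Suc.IH[of "t + 1"] le_add2)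
      (cases t; simp add: algebra_simps)
  also have "\<dots> = fact (Suc k) * fact (Suc (Suc k)) * (Suc (Suc k) choose t)"
    unfolding binomial_path_step[OF Suc.prems] by (simp add: algebra_simps)
  finally show ?case .
qed

text \<open>
  Let \<open>L\<close> be the linear functional on polynomials with \<open>L (x\<^sup>i) = moment i\<close>, and let
  \<open>N\<^sub>k = x (x + 1 \<sqdot> 2) \<cdots> (x + (k - 1) \<sqdot> k)\<close>. Then \<open>newton_moment k i\<close> is \<open>L (x\<^sup>i N\<^sub>k)\<close>. The polynomials
  \<open>F\<^sub>0 = F\<^sub>1 = 1\<close>, \<open>F\<^bsub>N+2\<^esub> = F\<^bsub>N+1\<^esub> - x F\<^sub>N\<close> enter through \<open>fib_moment N i = L (x\<^sup>i F\<^sub>N)\<close>.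
\<close>

definition moment :: "nat \<Rightarrow> int" where
  "moment i = (case i of 0 \<Rightarrow> 1 | Suc j \<Rightarrow> int (path_weight j 1))"

fun newton_moment :: "nat \<Rightarrow> nat \<Rightarrow> int" where
  "newton_moment 0 i = moment i"
| "newton_moment (Suc k) i = newton_moment k (Suc i) + int (k * (k + 1)) * newton_moment k i"

text \<open>The factor x of N_(k+1) turns moments into path weights, one index lower; the other
  factors are those of \<open>newton_path\<close>.\<close>

lemma newton_moment_Suc: "newton_moment (Suc k) i = int (newton_path k i 1)"
  by (induction k arbitrary: i) (simp_all add: moment_def algebra_simps)

lemma newton_moment_0: "newton_moment k 0 = (fact k)\<^sup>2"
proof (cases k)
  case (Suc j)
  then show ?thesis
    by (simp add: newton_moment_Suc newton_path_0 power2_eq_square algebra_simps del: newton_moment.simps)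
qed (simp add: moment_def)

text \<open>The central factorial numbers T(2n + 2, 2k + 2): the complete homogeneous symmetric
  polynomial of degree n - k in 1^2, ..., (k + 1)^2.\<close>

fun central_factorial :: "nat \<Rightarrow> nat \<Rightarrow> int" where
  "central_factorial 0 k = (if k = 0 then 1 else 0)"
| "central_factorial (Suc n) k =
     (int k + 1)\<^sup>2 * central_factorial n k + (if k = 0 then 0 else central_factorial n (k - 1))"

lemma central_factorial_eq_0: "n < k \<Longrightarrow> central_factorial n k = 0"
  by (induction n arbitrary: k) auto

fun fib_moment :: "nat \<Rightarrow> nat \<Rightarrow> int" where
  "fib_moment 0 i = moment i"
| "fib_moment (Suc 0) i = moment i"
| "fib_moment (Suc (Suc N)) i = fib_moment (Suc N) i - fib_moment N (Suc i)"

lemma newton_moment_shift: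
  "newton_moment k (Suc i) = newton_moment (Suc k) i - int k * (int k + 1) * newton_moment k i"
  by (simp add: algebra_simps)

text \<open>Summation by parts moves the recurrence of the coefficients onto \<open>g\<close>. The
  result vanishes whenever g (k + 1) = (k + 1)^2 g k.\<close>

lemma central_factorial_sum_Suc:
  fixes g :: "nat \<Rightarrow> int"
  shows "(\<Sum>k\<le>Suc n. (-1) ^ k * central_factorial (Suc n) k * g k) =
    (\<Sum>k\<le>n. (-1) ^ k * central_factorial n k * ((int k + 1)\<^sup>2 * g k - g (Suc k)))"
proof -
  have "(\<Sum>k\<le>Suc n. (-1) ^ k * central_factorial (Suc n) k * g k) =
      (\<Sum>k\<le>Suc n. (-1) ^ k * central_factorial n k * ((int k + 1)\<^sup>2 * g k))
      + (\<Sum>k\<le>Suc n. (-1) ^ k * (if k = 0 then 0 else central_factorial n (k - 1)) * g k)"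
    unfolding sum.distrib[symmetric] by (rule sum.cong) (auto simp: algebra_simps)
  also have "(\<Sum>k\<le>Suc n. (-1) ^ k * (if k = 0 then 0 else central_factorial n (k - 1)) * g k) =
      - (\<Sum>k\<le>n. (-1) ^ k * central_factorial n k * g (Suc k))"
    by (simp add: sum.atMost_Suc_shift sum_negf del: sum.atMost_Suc)
  finally show ?thesis
    by (simp add: central_factorial_eq_0 sum_subtractf algebra_simps)
qed

text \<open>
  The coefficients come from the generating function
  \<open>1 / (1 - z + x z\<^sup>2) = (\<Sum>k. (-1)\<^sup>k N\<^sub>k z\<^bsup>2k\<^esup> / ((1 - (k + 1) z) \<Prod>j=1..k. (1 - j\<^sup>2 z\<^sup>2)))\<close>.
\<close>

lemma fib_moment_expansion:
  "fib_moment (2 * n) i = (\<Sum>k\<le>n. (-1) ^ k * central_factorial n k * newton_moment k i) \<and>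
   fib_moment (Suc (2 * n)) i =
     (\<Sum>k\<le>n. (-1) ^ k * central_factorial n k * ((int k + 1) * newton_moment k i))"
proof (induction n arbitrary: i)
  case 0
  then show ?case by simp
next
  case (Suc n)
  note IH = conjunct1[OF Suc.IH] conjunct2[OF Suc.IH]
  have even: "fib_moment (2 * Suc n) i =
      (\<Sum>k\<le>Suc n. (-1) ^ k * central_factorial (Suc n) k * newton_moment k i)" for i
  proof -
    have "fib_moment (2 * Suc n) i = fib_moment (Suc (2 * n)) i - fib_moment (2 * n) (Suc i)"
      by simp
    \<comment> \<open>Since x N_k = N_(k+1) - k (k + 1) N_k and (k + 1) + k (k + 1) = (k + 1)^2, the
      difference is the right side of \<open>central_factorial_sum_Suc\<close>.\<close>
    also have "\<dots> = (\<Sum>k\<le>Suc n. (-1) ^ k * central_factorial (Suc n) k * newton_moment k i)"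
      unfolding central_factorial_sum_Suc
      unfolding IH newton_moment_shift sum_subtractf[symmetric]
      by (rule sum.cong) (simp_all add: power2_eq_square algebra_simps del: newton_moment.simps)
    finally show ?thesis .
  qed
  have "fib_moment (Suc (2 * Suc n)) i = fib_moment (2 * Suc n) i - fib_moment (Suc (2 * n)) (Suc i)"
    by simp
  also have "\<dots> = (\<Sum>k\<le>Suc n. (-1) ^ k * central_factorial (Suc n) k * ((int k + 1) * newton_moment k i))"
    unfolding even central_factorial_sum_Suc
    unfolding IH newton_moment_shift sum_subtractf[symmetric]
    by (rule sum.cong) (simp_all add: power2_eq_square algebra_simps del: newton_moment.simps)
  finally show ?case using even by simp
qed

text \<open>The values k!^2 satisfy (k + 1)^2 k!^2 = (k + 1)!^2, so after one use of the coefficient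
  recurrence every summand is 0. For n = 0 there is no such use, and the value is 1.\<close>

lemma fib_moment_eq_0: "1 \<le> n \<Longrightarrow> fib_moment (2 * n) 0 = 0"
proof -
  assume "1 \<le> n"
  then obtain l where n: "n = Suc l" by (cases n) auto
  show ?thesis
    unfolding conjunct1[OF fib_moment_expansion] newton_moment_0
    unfolding n central_factorial_sum_Suc by (simp add: power2_eq_square algebra_simps)
qed

text \<open>The coefficients of F_N lie on a diagonal of Pascal's triangle, and Pascal's rule
  becomes the Fibonacci recurrence.\<close>

lemma fib_moment_binomial:
  "fib_moment N i = (\<Sum>j\<le>N. (-1) ^ j * int ((N - j) choose j) * moment (i + j))"
proof (induction N i rule: fib_moment.induct)
  case (3 N i)
  have pascal: "int ((Suc N - j) choose Suc j) = int ((N - j) choose Suc j) + int ((N - j) choose j)"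
    if "j \<le> N" for j
    using that by (simp add: Suc_diff_le)
  have "(\<Sum>j\<le>Suc (Suc N). (-1) ^ j * int ((Suc (Suc N) - j) choose j) * moment (i + j))
     = moment i + (\<Sum>j\<le>Suc N. (-1) ^ Suc j * int ((Suc N - j) choose Suc j) * moment (i + Suc j))"
    by (simp add: sum.atMost_Suc_shift del: sum.atMost_Suc)
  also have "\<dots> = moment i + (\<Sum>j\<le>N. (-1) ^ Suc j * int ((N - j) choose Suc j) * moment (i + Suc j))
      + (\<Sum>j\<le>N. (-1) ^ Suc j * int ((N - j) choose j) * moment (i + Suc j))"
    by (simp add: pascal sum.distrib[symmetric] algebra_simps del: binomial_Suc_Suc)
  also have "moment i + (\<Sum>j\<le>N. (-1) ^ Suc j * int ((N - j) choose Suc j) * moment (i + Suc j))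
      = fib_moment (Suc N) i"
    unfolding 3 by (simp add: sum.atMost_Suc_shift del: sum.atMost_Suc)
  also have "(\<Sum>j\<le>N. (-1) ^ Suc j * int ((N - j) choose j) * moment (i + Suc j)) = - fib_moment N (Suc i)"
    unfolding 3 by (simp add: sum_negf[symmetric])
  finally show ?case by simp
qed simp_all

text \<open>
  The two recurrences of the Seidel triangle force the second difference of row \<open>2n + 1\<close> in \<open>k\<close> to be
  minus row \<open>2n - 1\<close>, so odd rows are polynomials in the basis \<open>(k + i) choose (2i + 1)\<close>. The even
  rows are shifted by one: \<open>seidel_poly_even n k\<close> is the entry \<open>k + 1\<close> of row \<open>2n\<close>.
\<close>

definition seidel_poly_odd :: "nat \<Rightarrow> nat \<Rightarrow> int" where
  "seidel_poly_odd n k = (\<Sum>i\<le>n. (-1) ^ i * moment (n - i) * int ((k + i) choose (2 * i + 1)))"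

definition seidel_poly_even :: "nat \<Rightarrow> nat \<Rightarrow> int" where
  "seidel_poly_even n k = (\<Sum>i\<le>n. (-1) ^ i * moment (n - i) * int ((k + i) choose (2 * i)))"

lemma seidel_poly_odd_0: "seidel_poly_odd n 0 = 0"
  by (simp add: seidel_poly_odd_def binomial_eq_0)

lemma seidel_poly_odd_Suc: "seidel_poly_odd n (Suc k) = seidel_poly_even n k + seidel_poly_odd n k"
  by (simp add: seidel_poly_odd_def seidel_poly_even_def sum.distrib[symmetric] algebra_simps)

lemma seidel_poly_even_Suc:
  "seidel_poly_even (Suc n) k = seidel_poly_odd n (Suc k) + seidel_poly_even (Suc n) (Suc k)"
proof -
  have shift: "seidel_poly_even (Suc n) l = moment (Suc n) -
      (\<Sum>i\<le>n. (-1) ^ i * moment (n - i) * int ((l + Suc i) choose (2 * i + 2)))" for l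
    by (simp add: seidel_poly_even_def sum.atMost_Suc_shift sum_negf del: sum.atMost_Suc)
  show ?thesis
    unfolding shift seidel_poly_odd_def
    by (simp add: sum.distrib[symmetric] algebra_simps sum_subtractf[symmetric])
qed

text \<open>The value at k = n stands for entry n + 1 of row 2n, just outside the triangle.
  Reversing the sum shows that it is, up to sign, the functional applied to F_(2n).\<close>

lemma seidel_poly_even_boundary: "1 \<le> n \<Longrightarrow> seidel_poly_even n n = 0"
proof -
  assume n: "1 \<le> n"
  have "(0::int) = (\<Sum>j\<le>2 * n. (-1) ^ j * int ((2 * n - j) choose j) * moment j)"
    using fib_moment_eq_0[OF n] unfolding fib_moment_binomial by simp
  also have "\<dots> = (\<Sum>j\<le>n. (-1) ^ j * int ((2 * n - j) choose j) * moment j)"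
    by (rule sum.mono_neutral_right) (auto simp: binomial_eq_0)
  also have "\<dots> = (\<Sum>i\<le>n. (-1) ^ (n - i) * int ((2 * n - (n - i)) choose (n - i)) * moment (n - i))"
    by (rule sum.reindex_bij_witness[of _ "\<lambda>i. n - i" "\<lambda>i. n - i"]) auto
  also have "\<dots> = (\<Sum>i\<le>n. (-1) ^ n * ((-1) ^ i * moment (n - i) * int ((n + i) choose (2 * i))))"
  proof (rule sum.cong)
    fix i assume i: "i \<in> {..n}"
    have "(n + i) choose (n - i) = (n + i) choose (2 * i)"
      using i by (subst binomial_symmetric) auto
    moreover have "2 * n - (n - i) = n + i" using i by auto
    moreover have "(-1 :: int) ^ (n - i) = (-1) ^ n * (-1) ^ i"
      using i by (auto simp: minus_one_power_iff)
    ultimately show "(-1) ^ (n - i) * int ((2 * n - (n - i)) choose (n - i)) * moment (n - i)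
      = (-1) ^ n * ((-1) ^ i * moment (n - i) * int ((n + i) choose (2 * i)))" by simp
  qed simp
  also have "\<dots> = (-1) ^ n * seidel_poly_even n n"
    unfolding seidel_poly_even_def by (rule sum_distrib_left[symmetric])
  finally show ?thesis by simp
qed

text \<open>The induction follows the order of filling: an odd row from left to right, then an even
  row from right to left, each starting from a zero just outside the triangle.\<close>

lemma seidel_eq_poly:
  "(\<forall>k \<le> Suc n. int (seidel (2 * n + 1) k) = seidel_poly_odd n k) \<and>
   (\<forall>k \<le> n. int (seidel (2 * n + 2) (Suc k)) = seidel_poly_even (Suc n) k)"
proof (induction n)
  case 0
  have [simp]: "seidel 1 0 = 0" "seidel (Suc 0) (Suc 0) = 1" "seidel (Suc (Suc 0)) (Suc 0) = 1"
    by (simp_all add: seidel.simps)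
  show ?case
    by (auto simp: le_Suc_eq seidel_outside seidel_poly_odd_def seidel_poly_even_def moment_def binomial_eq_0)
next
  case (Suc n)
  have odd: "int (seidel (2 * Suc n + 1) k) = seidel_poly_odd (Suc n) k" if "k \<le> Suc (Suc n)" for k
    using that
  proof (induction k)
    case 0
    then show ?case by (simp add: seidel_poly_odd_0 seidel_outside)
  next
    case (Suc k)
    have "int (seidel (2 * Suc n) (Suc k)) = seidel_poly_even (Suc n) k"
    proof (cases "k \<le> n")
      case True
      then show ?thesis using \<open>_ \<and> _\<close> by simp
    next
      case False
      \<comment> \<open>The odd row is one entry longer than the even row above it, so its last
        entry refers to a place outside; there the boundary lemma is needed.\<close>
      then have "k = Suc n" using Suc.prems by simp
      then show ?thesis by (simp add: seidel_poly_even_boundary seidel_outside)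
    qed
    then show ?case
      using Suc seidel_odd[of "Suc n" "Suc k"] by (simp add: seidel_poly_odd_Suc)
  qed
  have even: "int (seidel (2 * Suc n + 2) (Suc k)) = seidel_poly_even (Suc (Suc n)) k"
    if "k \<le> Suc (Suc n)" for k
    using that
  proof (induction rule: inc_induct)
    case base
    then show ?case by (simp add: seidel_poly_even_boundary seidel_outside)
  next
    case (step k)
    then show ?case
      using seidel_even[of "Suc k" "Suc (Suc n)"] odd[of "Suc k"]
      by (simp add: seidel_poly_even_Suc[of "Suc n" k])
  qed
  show ?case using odd even by auto
qed

lemma median_genocchi_path_weight: "median_genocchi n = path_weight n 1"
proof -
  have "int (median_genocchi n) = seidel_poly_even (Suc n) 0"
    unfolding median_genocchi_def using seidel_eq_poly[of n] by auto
  \<comment> \<open>At k = 0 only the summand i = 0 survives.\<close>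
  also have "\<dots> = int (path_weight n 1)"
    by (simp add: seidel_poly_even_def sum.atMost_Suc_shift binomial_eq_0 moment_def del: sum.atMost_Suc)
  finally show ?thesis by simp
qed

subsection \<open>Collapsed permutations\<close>

definition perfect_matchings :: "'a set \<Rightarrow> 'b set \<Rightarrow> ('a \<times> 'b) set \<Rightarrow> ('a \<times> 'b) set set" where
  "perfect_matchings X Y E =
     {M. M \<subseteq> E \<inter> X \<times> Y \<and> (\<forall>x\<in>X. \<exists>!y. (x, y) \<in> M) \<and> (\<forall>y\<in>Y. \<exists>!x. (x, y) \<in> M)}"

lemma finite_perfect_matchings: "finite X \<Longrightarrow> finite Y \<Longrightarrow> finite (perfect_matchings X Y E)"
  by (rule finite_subset[of _ "Pow (X \<times> Y)"]) (auto simp: perfect_matchings_def)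

lemma perfect_matchings_cong:
  "E \<inter> X \<times> Y = E' \<inter> X \<times> Y \<Longrightarrow> perfect_matchings X Y E = perfect_matchings X Y E'"
  by (simp add: perfect_matchings_def)

lemma perfect_matchingsI:
  assumes "M \<subseteq> E \<inter> X \<times> Y" "\<And>x. x \<in> X \<Longrightarrow> \<exists>!y. (x, y) \<in> M" "\<And>y. y \<in> Y \<Longrightarrow> \<exists>!x. (x, y) \<in> M"
  shows "M \<in> perfect_matchings X Y E"
  using assms by (simp add: perfect_matchings_def)

lemma perfect_matchingsD:
  assumes "M \<in> perfect_matchings X Y E"
  shows "M \<subseteq> E \<inter> X \<times> Y" "x \<in> X \<Longrightarrow> \<exists>!y. (x, y) \<in> M" "y \<in> Y \<Longrightarrow> \<exists>!x. (x, y) \<in> M"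
  using assms by (simp_all add: perfect_matchings_def)

lemma card_perfect_matchings_through_edge:
  assumes "x \<in> X" "y \<in> Y" "(x, y) \<in> E"
  shows "card {M \<in> perfect_matchings X Y E. (x, y) \<in> M} = card (perfect_matchings (X - {x}) (Y - {y}) E)"
proof -
  have "bij_betw (insert (x, y)) (perfect_matchings (X - {x}) (Y - {y}) E)
      {M \<in> perfect_matchings X Y E. (x, y) \<in> M}"
  proof (rule bij_betwI[where g = "\<lambda>M. M - {(x, y)}"])
    show "insert (x, y) \<in> perfect_matchings (X - {x}) (Y - {y}) E
        \<rightarrow> {M \<in> perfect_matchings X Y E. (x, y) \<in> M}"
    proof
      fix M assume M: "M \<in> perfect_matchings (X - {x}) (Y - {y}) E"
      note sub = perfect_matchingsD(1)[OF M]
      have notin: "(x, v) \<notin> M" "(u, y) \<notin> M" for u v using sub by auto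
      have "insert (x, y) M \<in> perfect_matchings X Y E"
      proof (rule perfect_matchingsI)
        show "insert (x, y) M \<subseteq> E \<inter> X \<times> Y" using sub assms by auto
        show "\<exists>!v. (u, v) \<in> insert (x, y) M" if "u \<in> X" for u
          using perfect_matchingsD(2)[OF M, of u] that notin by (cases "u = x") simp_all
        show "\<exists>!u. (u, v) \<in> insert (x, y) M" if "v \<in> Y" for v
          using perfect_matchingsD(3)[OF M, of v] that notin by (cases "v = y") simp_all
      qed
      then show "insert (x, y) M \<in> {M \<in> perfect_matchings X Y E. (x, y) \<in> M}" by simp
    qed
    show "(\<lambda>M. M - {(x, y)}) \<in> {M \<in> perfect_matchings X Y E. (x, y) \<in> M}
        \<rightarrow> perfect_matchings (X - {x}) (Y - {y}) E"
    proof
      fix M assume "M \<in> {M \<in> perfect_matchings X Y E. (x, y) \<in> M}"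
      then have M: "M \<in> perfect_matchings X Y E" and xy: "(x, y) \<in> M" by simp_all
      have unique: "v = y" if "(x, v) \<in> M" for v
        using perfect_matchingsD(2)[OF M assms(1)] that xy by blast
      have unique': "u = x" if "(u, y) \<in> M" for u
        using perfect_matchingsD(3)[OF M assms(2)] that xy by blast
      show "M - {(x, y)} \<in> perfect_matchings (X - {x}) (Y - {y}) E"
      proof (rule perfect_matchingsI)
        show "M - {(x, y)} \<subseteq> E \<inter> (X - {x}) \<times> (Y - {y})"
          using perfect_matchingsD(1)[OF M] unique unique' by auto
        show "\<exists>!v. (u, v) \<in> M - {(x, y)}" if "u \<in> X - {x}" for u
          using perfect_matchingsD(2)[OF M, of u] that by simp
        show "\<exists>!u. (u, v) \<in> M - {(x, y)}" if "v \<in> Y - {y}" for v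
          using perfect_matchingsD(3)[OF M, of v] that by simp
      qed
    qed
    show "insert (x, y) M - {(x, y)} = M" if "M \<in> perfect_matchings (X - {x}) (Y - {y}) E" for M
      using perfect_matchingsD(1)[OF that] by auto
    show "insert (x, y) (M - {(x, y)}) = M" if "M \<in> {M \<in> perfect_matchings X Y E. (x, y) \<in> M}" for M
      using that by auto
  qed
  then show ?thesis by (simp add: bij_betw_same_card)
qed

text \<open>A partial expansion: row \<open>x\<close> is matched into \<open>C\<close>, or its edges
  to \<open>C\<close> are struck out and its choice is postponed.\<close>

lemma card_perfect_matchings_split_row:
  assumes fin: "finite X" "finite Y" and x: "x \<in> X" and C: "C \<subseteq> Y" "{x} \<times> C \<subseteq> E"
  shows "card (perfect_matchings X Y E) =
    (\<Sum>y\<in>C. card (perfect_matchings (X - {x}) (Y - {y}) E)) + card (perfect_matchings X Y (E - {x} \<times> C))"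
proof -
  let ?T = "\<lambda>y. {M \<in> perfect_matchings X Y E. (x, y) \<in> M}"
  have "perfect_matchings X Y E = (\<Union>y\<in>C. ?T y) \<union> perfect_matchings X Y (E - {x} \<times> C)"
    by (auto simp: perfect_matchings_def)
  moreover have "(\<Union>y\<in>C. ?T y) \<inter> perfect_matchings X Y (E - {x} \<times> C) = {}"
    by (auto simp: perfect_matchings_def)
  moreover have "finite (\<Union>y\<in>C. ?T y)"
    by (rule finite_subset[OF _ finite_perfect_matchings[OF fin, of E]]) auto
  ultimately have "card (perfect_matchings X Y E) =
      card (\<Union>y\<in>C. ?T y) + card (perfect_matchings X Y (E - {x} \<times> C))"
    using finite_perfect_matchings[OF fin] by (metis (no_types, lifting) card_Un_disjoint)
  moreover have "card (\<Union>y\<in>C. ?T y) = (\<Sum>y\<in>C. card (?T y))"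
  proof (rule card_UN_disjoint)
    show "\<forall>i\<in>C. \<forall>j\<in>C. i \<noteq> j \<longrightarrow> ?T i \<inter> ?T j = {}"
      using x by (auto simp: perfect_matchings_def)
  qed (use C fin finite_perfect_matchings[OF fin, of E] in \<open>auto intro: finite_subset\<close>)
  moreover have "(\<Sum>y\<in>C. card (?T y)) = (\<Sum>y\<in>C. card (perfect_matchings (X - {x}) (Y - {y}) E))"
    by (rule sum.cong) (use C x in \<open>auto intro!: card_perfect_matchings_through_edge\<close>)
  ultimately show ?thesis by simp
qed

lemma card_perfect_matchings_column:
  assumes fin: "finite X" "finite Y" and y: "y \<in> Y"
  shows "card (perfect_matchings X Y E) =
    (\<Sum>x | x \<in> X \<and> (x, y) \<in> E. card (perfect_matchings (X - {x}) (Y - {y}) E))"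
proof -
  let ?T = "\<lambda>x. {M \<in> perfect_matchings X Y E. (x, y) \<in> M}"
  let ?A = "{x. x \<in> X \<and> (x, y) \<in> E}"
  have "perfect_matchings X Y E = (\<Union>x\<in>?A. ?T x)"
    using y by (fastforce simp: perfect_matchings_def)
  moreover have "card (\<Union>x\<in>?A. ?T x) = (\<Sum>x\<in>?A. card (?T x))"
  proof (rule card_UN_disjoint)
    show "\<forall>i\<in>?A. \<forall>j\<in>?A. i \<noteq> j \<longrightarrow> ?T i \<inter> ?T j = {}"
      using y by (auto simp: perfect_matchings_def)
  qed (use fin finite_perfect_matchings[OF fin, of E] in auto)
  moreover have "(\<Sum>x\<in>?A. card (?T x)) = (\<Sum>x\<in>?A. card (perfect_matchings (X - {x}) (Y - {y}) E))"
    by (rule sum.cong) (use y in \<open>auto intro!: card_perfect_matchings_through_edge\<close>)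
  ultimately show ?thesis by simp
qed

definition band :: "nat \<Rightarrow> (nat \<times> nat) set" where
  "band m = {(k, y). 1 + k div 2 \<le> y \<and> y \<le> m + k div 2}"

text \<open>
  Write a value of the inverse permutation as \<open>y \<le> m\<close> or as \<open>m + w\<close>. Column \<open>y\<close> of the band accepts
  the rows \<open>< 2y\<close> and column \<open>m + w\<close> the rows \<open>\<ge> 2w\<close>. Scanning rows and columns simultaneously, \<open>R\<close> is
  the set of rows already passed that still wait for a small column, and \<open>C\<close> the set of large columns
  already passed that still wait for a row; \<open>k\<close>, \<open>s\<close> and \<open>m + l\<close> are the next row, small column and
  large column.
\<close>

definition scan_count :: "nat \<Rightarrow> nat set \<Rightarrow> nat set \<Rightarrow> nat \<Rightarrow> nat \<Rightarrow> nat \<Rightarrow> nat" where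
  "scan_count m R C k s l = card (perfect_matchings (R \<union> {k..2 * m}) (C \<union> {s..m} \<union> {m + l..2 * m})
     (band m - R \<times> {m<..}))"

text \<open>The large columns still free and open to row \<open>k\<close> are exactly those in
  \<open>C\<close>. The row takes one of them now or joins the rows waiting for a small
  column.\<close>

lemma scan_count_row:
  assumes "k div 2 = v" "v \<le> m" "k \<le> 2 * m" and R: "R \<subseteq> {1..<k}" and C: "C \<subseteq> {m<..m + v}"
  shows "scan_count m R C k (Suc v) (Suc v) =
    (\<Sum>y\<in>C. scan_count m R (C - {y}) (Suc k) (Suc v) (Suc v))
    + scan_count m (insert k R) C (Suc k) (Suc v) (Suc v)"
proof -
  let ?X = "R \<union> {k..2 * m}" and ?Y = "C \<union> {Suc v..m} \<union> {m + Suc v..2 * m}"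
  let ?E = "band m - R \<times> {m<..}"
  have fin: "finite ?X" "finite ?Y" using R C by (auto intro: finite_subset)
  have kR: "k \<notin> R" using R by auto
  have X: "?X - {k} = R \<union> {Suc k..2 * m}" "?X = insert k R \<union> {Suc k..2 * m}"
    using assms by auto
  have Y: "?Y - {y} = (C - {y}) \<union> {Suc v..m} \<union> {m + Suc v..2 * m}" if "y \<in> C" for y
    using that C by fastforce
  have "card (perfect_matchings ?X ?Y ?E) =
    (\<Sum>y\<in>C. card (perfect_matchings (?X - {k}) (?Y - {y}) ?E))
    + card (perfect_matchings ?X ?Y (?E - {k} \<times> C))"
    by (rule card_perfect_matchings_split_row[OF fin]) (use assms kR in \<open>auto simp: band_def\<close>)
  moreover have "(\<Sum>y\<in>C. card (perfect_matchings (?X - {k}) (?Y - {y}) ?E)) =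
      (\<Sum>y\<in>C. scan_count m R (C - {y}) (Suc k) (Suc v) (Suc v))"
  proof (rule sum.cong)
    fix y assume y: "y \<in> C"
    show "card (perfect_matchings (?X - {k}) (?Y - {y}) ?E) =
        scan_count m R (C - {y}) (Suc k) (Suc v) (Suc v)"
      unfolding scan_count_def X(1) Y[OF y] ..
  qed simp
  \<comment> \<open>Large columns not yet passed begin at m + v + 1, outside the band of row
    \<open>k\<close>, so barring it from \<open>C\<close> bars it from all large columns.\<close>
  moreover have "perfect_matchings ?X ?Y (?E - {k} \<times> C) =
      perfect_matchings ?X ?Y (band m - insert k R \<times> {m<..})"
    by (rule perfect_matchings_cong) (use assms in \<open>auto simp: band_def\<close>)
  ultimately show ?thesis
    unfolding scan_count_def X(2)[symmetric] by simp
qed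

lemma scan_count_column:
  assumes "1 \<le> v" "v \<le> m" and R: "R \<subseteq> {1..<2 * v}" and C: "C \<subseteq> {m<..<m + v}"
  shows "scan_count m R C (2 * v) v v =
    (\<Sum>x\<in>R. scan_count m (R - {x}) (insert (m + v) C) (2 * v) (Suc v) (Suc v))"
proof -
  let ?X = "R \<union> {2 * v..2 * m}" and ?Y = "C \<union> {v..m} \<union> {m + v..2 * m}"
  let ?E = "band m - R \<times> {m<..}"
  have fin: "finite ?X" "finite ?Y" using R C by (auto intro: finite_subset)
  have "card (perfect_matchings ?X ?Y ?E) =
    (\<Sum>x | x \<in> ?X \<and> (x, v) \<in> ?E. card (perfect_matchings (?X - {x}) (?Y - {v}) ?E))"
    by (rule card_perfect_matchings_column[OF fin]) (use assms in auto)
  \<comment> \<open>Column \<open>v\<close> accepts only rows below 2v, and of these only the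
    waiting ones are left.\<close>
  also have "{x. x \<in> ?X \<and> (x, v) \<in> ?E} = R"
  proof -
    have "x div 2 < v" if "x \<in> R" for x
      using that R by (intro less_mult_imp_div_less) (auto simp: mult.commute)
    then show ?thesis using assms by (auto simp: band_def Suc_le_eq)
  qed
  also have "(\<Sum>x\<in>R. card (perfect_matchings (?X - {x}) (?Y - {v}) ?E)) =
      (\<Sum>x\<in>R. scan_count m (R - {x}) (insert (m + v) C) (2 * v) (Suc v) (Suc v))"
  proof (rule sum.cong)
    fix x assume x: "x \<in> R"
    have "?X - {x} = (R - {x}) \<union> {2 * v..2 * m}" using x R by auto
    moreover have "?Y - {v} = insert (m + v) C \<union> {Suc v..m} \<union> {m + Suc v..2 * m}"
      using assms by auto
    moreover have "perfect_matchings (?X - {x}) (?Y - {v}) ?E =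
        perfect_matchings (?X - {x}) (?Y - {v}) (band m - (R - {x}) \<times> {m<..})"
      by (rule perfect_matchings_cong) auto
    ultimately show "card (perfect_matchings (?X - {x}) (?Y - {v}) ?E) =
        scan_count m (R - {x}) (insert (m + v) C) (2 * v) (Suc v) (Suc v)"
      by (simp add: scan_count_def)
  qed simp
  finally show ?thesis by (simp add: scan_count_def)
qed

text \<open>No small column is left, so a waiting row cannot be matched any more. Without waiting
  rows, row 2m takes column 2m.\<close>

lemma scan_count_last:
  assumes "1 \<le> m" "R \<subseteq> {1..<2 * m}" "C \<subseteq> {m<..<2 * m}" "card C = card R"
  shows "scan_count m R (insert (m + m) C) (2 * m) (Suc m) (Suc m) = (if R = {} then 1 else 0)"
proof (cases "R = {}")
  case True
  then have "C = {}" using assms finite_subset[OF assms(3)] by simp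
  have "perfect_matchings {2 * m} {2 * m} (band m) = {{(2 * m, 2 * m)}}"
    using assms by (auto simp: perfect_matchings_def band_def)
  then show ?thesis
    using True \<open>C = {}\<close> by (simp add: scan_count_def mult_2)
next
  case False
  then obtain r where "r \<in> R" by auto
  have "perfect_matchings (R \<union> {2 * m..2 * m}) (insert (m + m) C \<union> {Suc m..m} \<union> {m + Suc m..2 * m})
      (band m - R \<times> {m<..}) = {}"
  proof (rule equals0I)
    fix M assume M: "M \<in> perfect_matchings (R \<union> {2 * m..2 * m})
      (insert (m + m) C \<union> {Suc m..m} \<union> {m + Suc m..2 * m}) (band m - R \<times> {m<..})"
    then obtain y where "(r, y) \<in> M" using \<open>r \<in> R\<close> by (auto simp: perfect_matchings_def)
    then show False using M \<open>r \<in> R\<close> assms by (fastforce simp: perfect_matchings_def)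
  qed
  then show ?thesis using False by (simp add: scan_count_def)
qed

text \<open>One stage treats column \<open>v\<close> and rows 2v, 2v + 1. With a waiting rows it has
  a^2 (a - 1), 2 a^2 and a ways to end at heights a - 1, a and a + 1; the factor a! turns these into
  the path weights.\<close>

lemma scan_count_path_weight:
  assumes "1 \<le> v" "v + n = m" "R \<subseteq> {1..<2 * v}" "C \<subseteq> {m<..<m + v}" "card R = Suc (card C)"
  shows "scan_count m R C (2 * v) v v = fact (card R) * path_weight n (card R)"
  using assms
proof (induction n arbitrary: v R C)
  case 0
  have fR: "finite R" using finite_subset[OF 0(3)] by simp
  have "scan_count m R C (2 * v) v v =
      (\<Sum>x\<in>R. scan_count m (R - {x}) (insert (m + v) C) (2 * v) (Suc v) (Suc v))"
    by (rule scan_count_column) (use 0 in auto)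
  also have "\<dots> = (\<Sum>x\<in>R. if card R = 1 then 1 else 0)"
  proof (rule sum.cong)
    fix x assume x: "x \<in> R"
    have "R - {x} = {} \<longleftrightarrow> card R = 1"
      using x fR by (metis One_nat_def card_0_eq card_Suc_Diff1 finite_Diff nat.inject)
    moreover have "card C = card (R - {x})" using 0 x fR by simp
    moreover have "v = m" "1 \<le> m" "R - {x} \<subseteq> {1..<2 * m}" "C \<subseteq> {m<..<2 * m}"
      using 0 by auto
    ultimately show "scan_count m (R - {x}) (insert (m + v) C) (2 * v) (Suc v) (Suc v)
        = (if card R = 1 then 1 else 0)"
      using scan_count_last[of m "R - {x}" C] by simp
  qed simp
  finally show ?case by simp
next
  case (Suc n)
  have fR: "finite R" and fC: "finite C"
    using finite_subset[OF Suc.prems(3)] finite_subset[OF Suc.prems(4)] by simp_all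
  define a where "a = card R"
  have a: "1 \<le> a" "card C = a - 1" using Suc.prems(5) by (auto simp: a_def)
  let ?\<phi> = "\<lambda>a. fact a * path_weight n a"
  have IH: "scan_count m R' C' (2 * v + 2) (Suc v) (Suc v) = ?\<phi> (card R')"
    if "R' \<subseteq> {1..<2 * v + 2}" "C' \<subseteq> {m<..m + v}" "card R' = Suc (card C')" for R' C'
  proof -
    have eq: "2 * v + 2 = 2 * Suc v" "{m<..m + v} = {m<..<m + Suc v}" by auto
    show ?thesis using that Suc.prems(1,2) unfolding eq by (intro Suc.IH) auto
  qed
  \<comment> \<open>Row 2v + 1 takes one of the waiting columns or waits itself.\<close>
  have second: "scan_count m R' C' (2 * v + 1) (Suc v) (Suc v) =
      card C' * ?\<phi> (card C') + ?\<phi> (Suc (card C'))"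
    if sub: "R' \<subseteq> {1..<2 * v + 1}" "C' \<subseteq> {m<..m + v}" and card: "card R' = card C'" for R' C'
  proof -
    have fin: "finite R'" "finite C'"
      using finite_subset[OF sub(1)] finite_subset[OF sub(2)] by simp_all
    have "scan_count m R' C' (2 * v + 1) (Suc v) (Suc v) =
      (\<Sum>y\<in>C'. scan_count m R' (C' - {y}) (Suc (2 * v + 1)) (Suc v) (Suc v))
      + scan_count m (insert (2 * v + 1) R') C' (Suc (2 * v + 1)) (Suc v) (Suc v)"
      by (rule scan_count_row) (use sub Suc.prems in auto)
    also have "(\<Sum>y\<in>C'. scan_count m R' (C' - {y}) (Suc (2 * v + 1)) (Suc v) (Suc v)) =
        (\<Sum>y\<in>C'. ?\<phi> (card C'))"
    proof (rule sum.cong)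
      fix y assume y: "y \<in> C'"
      then have card': "card R' = Suc (card (C' - {y}))" using card fin by (metis card_Suc_Diff1)
      have sub': "R' \<subseteq> {1..<2 * v + 2}" "C' - {y} \<subseteq> {m<..m + v}" using sub by auto
      show "scan_count m R' (C' - {y}) (Suc (2 * v + 1)) (Suc v) (Suc v) = ?\<phi> (card C')"
        using IH[OF sub' card'] card by simp
    qed simp
    also have "scan_count m (insert (2 * v + 1) R') C' (Suc (2 * v + 1)) (Suc v) (Suc v) = ?\<phi> (Suc (card C'))"
    proof -
      have "2 * v + 1 \<notin> R'" using sub by auto
      then have "card (insert (2 * v + 1) R') = Suc (card C')" using fin card by simp
      moreover have "insert (2 * v + 1) R' \<subseteq> {1..<2 * v + 2}" using sub(1) by auto
      ultimately show ?thesis using IH[of "insert (2 * v + 1) R'" C'] sub(2) by simp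
    qed
    finally show ?thesis by simp
  qed
  \<comment> \<open>Row 2v comes after column \<open>v\<close> has used up a waiting row and column
    \<open>m + v\<close> has joined the waiting columns, hence the surplus of one column.\<close>
  have first: "scan_count m R' C' (2 * v) (Suc v) (Suc v) =
      card C' * ((card C' - 1) * ?\<phi> (card C' - 1) + ?\<phi> (card C')) + card C' * ?\<phi> (card C') + ?\<phi> (Suc (card C'))"
    if sub: "R' \<subseteq> {1..<2 * v}" "C' \<subseteq> {m<..m + v}" and card: "Suc (card R') = card C'" for R' C'
  proof -
    have fin: "finite R'" "finite C'"
      using finite_subset[OF sub(1)] finite_subset[OF sub(2)] by simp_all
    have "scan_count m R' C' (2 * v) (Suc v) (Suc v) =
      (\<Sum>y\<in>C'. scan_count m R' (C' - {y}) (Suc (2 * v)) (Suc v) (Suc v))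
      + scan_count m (insert (2 * v) R') C' (Suc (2 * v)) (Suc v) (Suc v)"
      by (rule scan_count_row) (use sub Suc.prems in auto)
    also have "(\<Sum>y\<in>C'. scan_count m R' (C' - {y}) (Suc (2 * v)) (Suc v) (Suc v)) =
        (\<Sum>y\<in>C'. (card C' - 1) * ?\<phi> (card C' - 1) + ?\<phi> (card C'))"
    proof (rule sum.cong)
      fix y assume y: "y \<in> C'"
      then have "Suc (card (C' - {y})) = card C'" using fin by (metis card_Suc_Diff1)
      then have card': "card (C' - {y}) = card C' - 1" "Suc (card C' - 1) = card C'"
        "card R' = card (C' - {y})"
        using card by simp_all
      have sub': "R' \<subseteq> {1..<2 * v + 1}" "C' - {y} \<subseteq> {m<..m + v}" using sub by auto
      show "scan_count m R' (C' - {y}) (Suc (2 * v)) (Suc v) (Suc v)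
          = (card C' - 1) * ?\<phi> (card C' - 1) + ?\<phi> (card C')"
        using second[OF sub' card'(3)] unfolding card'(1,2) by (simp only: Suc_eq_plus1)
    qed simp
    also have "scan_count m (insert (2 * v) R') C' (Suc (2 * v)) (Suc v) (Suc v)
        = card C' * ?\<phi> (card C') + ?\<phi> (Suc (card C'))"
    proof -
      have "2 * v \<notin> R'" using sub by auto
      then have "card (insert (2 * v) R') = card C'" using fin card by simp
      moreover have "insert (2 * v) R' \<subseteq> {1..<2 * v + 1}" using sub(1) Suc.prems(1) by auto
      ultimately show ?thesis using second[of "insert (2 * v) R'" C'] sub(2) by simp
    qed
    finally show ?thesis by simp
  qed
  have "scan_count m R C (2 * v) v v =
      (\<Sum>x\<in>R. scan_count m (R - {x}) (insert (m + v) C) (2 * v) (Suc v) (Suc v))"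
    by (rule scan_count_column) (use Suc.prems in auto)
  also have "\<dots> = (\<Sum>x\<in>R. a * ((a - 1) * ?\<phi> (a - 1) + ?\<phi> a) + a * ?\<phi> a + ?\<phi> (Suc a))"
  proof (rule sum.cong)
    fix x assume x: "x \<in> R"
    have "m + v \<notin> C" using Suc.prems(4) by auto
    then have C': "card (insert (m + v) C) = a" using fC a by simp
    have R': "Suc (card (R - {x})) = a" using x fR unfolding a_def by (metis card_Suc_Diff1)
    have "R - {x} \<subseteq> {1..<2 * v}" "insert (m + v) C \<subseteq> {m<..m + v}"
      using Suc.prems(1,3,4) by auto
    then show "scan_count m (R - {x}) (insert (m + v) C) (2 * v) (Suc v) (Suc v) =
        a * ((a - 1) * ?\<phi> (a - 1) + ?\<phi> a) + a * ?\<phi> a + ?\<phi> (Suc a)"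
      using first[of "R - {x}" "insert (m + v) C"] C' R' by simp
  qed simp
  also have "\<dots> = a * (a * ((a - 1) * ?\<phi> (a - 1) + ?\<phi> a) + a * ?\<phi> a + ?\<phi> (Suc a))"
    by (simp add: a_def)
  also have "\<dots> = fact a * path_weight (Suc n) a"
    using a(1) by (cases a) (simp_all add: algebra_simps power2_eq_square)
  finally show ?case by (simp add: a_def)
qed

section \<open>From collapsed permutations to matchings of the band\<close>

lemma card_permutations_perfect_matchings:
  "card {\<pi>. \<pi> permutes S \<and> (\<forall>i\<in>S. (\<pi> i, i) \<in> E)} = card (perfect_matchings S S E)"
proof -
  \<comment> \<open>Pairs are (value, position), because the collapsed condition bounds the position
    of each value.\<close>
  let ?G = "\<lambda>\<pi>. (\<lambda>i. (\<pi> i, i)) ` S"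
  have "bij_betw ?G {\<pi>. \<pi> permutes S \<and> (\<forall>i\<in>S. (\<pi> i, i) \<in> E)} (perfect_matchings S S E)"
    unfolding bij_betw_def
  proof
    show "inj_on ?G {\<pi>. \<pi> permutes S \<and> (\<forall>i\<in>S. (\<pi> i, i) \<in> E)}"
    proof (rule inj_onI, rule ext)
      fix \<pi> \<rho> i
      assume a: "\<pi> \<in> {\<pi>. \<pi> permutes S \<and> (\<forall>i\<in>S. (\<pi> i, i) \<in> E)}"
        "\<rho> \<in> {\<pi>. \<pi> permutes S \<and> (\<forall>i\<in>S. (\<pi> i, i) \<in> E)}" and eq: "?G \<pi> = ?G \<rho>"
      show "\<pi> i = \<rho> i"
      proof (cases "i \<in> S")
        case True
        then have "(\<pi> i, i) \<in> ?G \<rho>" using eq by blast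
        then show ?thesis by auto
      next
        case False
        then show ?thesis using a permutes_not_in[of \<pi> S i] permutes_not_in[of \<rho> S i] by simp
      qed
    qed
    show "?G ` {\<pi>. \<pi> permutes S \<and> (\<forall>i\<in>S. (\<pi> i, i) \<in> E)} = perfect_matchings S S E"
    proof (intro equalityI subsetI)
      fix M assume "M \<in> ?G ` {\<pi>. \<pi> permutes S \<and> (\<forall>i\<in>S. (\<pi> i, i) \<in> E)}"
      then obtain \<pi> where \<pi>: "\<pi> permutes S" "\<forall>i\<in>S. (\<pi> i, i) \<in> E" "M = ?G \<pi>" by auto
      have "\<exists>!y. (x, y) \<in> M" if "x \<in> S" for x
      proof -
        have "x \<in> \<pi> ` S" using permutes_image[OF \<pi>(1)] that by simp
        then obtain i where "i \<in> S" "x = \<pi> i" by auto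
        then show ?thesis using \<pi>(3) permutes_inj[OF \<pi>(1)] by (auto dest: injD)
      qed
      then show "M \<in> perfect_matchings S S E"
        using \<pi> permutes_in_image[OF \<pi>(1)] by (auto simp: perfect_matchings_def)
    next
      fix M assume "M \<in> perfect_matchings S S E"
      then have M: "M \<subseteq> E \<inter> S \<times> S" "\<And>x. x \<in> S \<Longrightarrow> \<exists>!y. (x, y) \<in> M"
          "\<And>y. y \<in> S \<Longrightarrow> \<exists>!x. (x, y) \<in> M"
        by (auto simp: perfect_matchings_def)
      define \<pi> where "\<pi> i = (if i \<in> S then THE x. (x, i) \<in> M else i)" for i
      have in_M: "(\<pi> i, i) \<in> M" if "i \<in> S" for i
        using theI'[OF M(3)[OF that]] that by (simp add: \<pi>_def)
      have eq: "\<pi> i = x" if "(x, i) \<in> M" for x i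
        using in_M[of i] M(1,3) that by blast
      have "bij_betw \<pi> S S"
        unfolding bij_betw_def
      proof (intro conjI inj_onI equalityI subsetI)
        fix i j assume "i \<in> S" "j \<in> S" "\<pi> i = \<pi> j"
        then show "i = j" using in_M[of i] in_M[of j] M(1,2) by (metis IntD2 SigmaD1 subsetD)
      next
        fix x assume "x \<in> \<pi> ` S"
        then show "x \<in> S" using in_M M(1) by auto
      next
        fix x assume "x \<in> S"
        then obtain i where "(x, i) \<in> M" using ex1_implies_ex[OF M(2)] by blast
        then show "x \<in> \<pi> ` S" using eq M(1) by blast
      qed
      then have "\<pi> permutes S"
        by (rule bij_imp_permutes) (simp add: \<pi>_def)
      moreover have "?G \<pi> = M" using in_M eq M(1) by force
      moreover have "\<forall>i\<in>S. (\<pi> i, i) \<in> E" using in_M M(1) by blast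
      ultimately show "M \<in> ?G ` {\<pi>. \<pi> permutes S \<and> (\<forall>i\<in>S. (\<pi> i, i) \<in> E)}" by blast
    qed
  qed
  then show ?thesis by (rule bij_betw_same_card)
qed

lemma num_collapsed_path_weight: "num_collapsed (n + 1) = path_weight n 1"
proof -
  define m where "m = n + 1"
  let ?S = "{1..2 * m}"
  have "(\<forall>k\<in>?S. 1 + k div 2 \<le> inv \<pi> k \<and> inv \<pi> k \<le> m + k div 2) \<longleftrightarrow> (\<forall>i\<in>?S. (\<pi> i, i) \<in> band m)"
    if \<pi>: "\<pi> permutes ?S" for \<pi>
  proof -
    have "(\<forall>k\<in>?S. 1 + k div 2 \<le> inv \<pi> k \<and> inv \<pi> k \<le> m + k div 2) \<longleftrightarrow>
        (\<forall>k\<in>\<pi> ` ?S. 1 + k div 2 \<le> inv \<pi> k \<and> inv \<pi> k \<le> m + k div 2)"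
      by (simp only: permutes_image[OF \<pi>])
    then show ?thesis by (simp add: permutes_inverses[OF \<pi>] band_def)
  qed
  then have "{\<pi>. collapsed m \<pi>} = {\<pi>. \<pi> permutes ?S \<and> (\<forall>i\<in>?S. (\<pi> i, i) \<in> band m)}"
    unfolding collapsed_def by blast
  then have "num_collapsed m = card (perfect_matchings ?S ?S (band m))"
    unfolding num_collapsed_def by (simp only: card_permutations_perfect_matchings)
  \<comment> \<open>Row 1 meets only small columns, so the scan may start at row 2 with row 1
    waiting, at height 1.\<close>
  also have "perfect_matchings ?S ?S (band m) = perfect_matchings ?S ?S (band m - {1} \<times> {m<..})"
    by (rule perfect_matchings_cong) (auto simp: band_def)
  also have "card \<dots> = scan_count m {1} {} (2 * 1) 1 1"
  proof -
    have "{1} \<union> {2 * 1..2 * m} = ?S" "{} \<union> {1..m} \<union> {m + 1..2 * m} = ?S"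
      by (auto simp: m_def)
    then show ?thesis by (simp only: scan_count_def)
  qed
  also have "\<dots> = path_weight n 1"
    using scan_count_path_weight[of 1 n m "{1}" "{}"] by (simp add: m_def)
  finally show ?thesis by (simp add: m_def)
qed

subsection \<open>Permutations with ascents from odd to even\<close>

definition ascent_ok :: "nat \<Rightarrow> nat \<Rightarrow> bool" where
  "ascent_ok x y \<longleftrightarrow> (x < y \<longrightarrow> odd x \<and> even y)"

text \<open>Each gap between two blocks will receive larger letters, so the letter before it starts
  an ascent and must be odd.\<close>

fun admissible :: "nat list list \<Rightarrow> bool" where
  "admissible [] = False"
| "admissible (b # bs) = (b \<noteq> [] \<and> successively ascent_ok b \<and>
     (if bs = [] then last b = 0 else odd (last b) \<and> admissible bs))"

text \<open>
  Partial words on the letters \<open>0, \<dots>, v\<close>, cut into blocks between which larger letters are still to be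
  inserted. The letter \<open>0\<close> is an endmarker: it makes the last letter of a word precede a smaller one,
  so that an even letter can never end a block.
\<close>

definition block_words :: "nat \<Rightarrow> nat \<Rightarrow> nat list list set" where
  "block_words v t = {bs. length bs = t \<and> admissible bs \<and> distinct (concat bs) \<and> set (concat bs) = {0..v}}"

lemma admissible_append:
  "ws \<noteq> [] \<Longrightarrow> admissible (us @ ws) \<longleftrightarrow>
     (\<forall>b\<in>set us. b \<noteq> [] \<and> successively ascent_ok b \<and> odd (last b)) \<and> admissible ws"
  by (induction us) auto

lemma finite_block_words: "finite (block_words v t)"
proof -
  let ?B = "{b :: nat list. set b \<subseteq> {0..v} \<and> length b \<le> Suc v}"
  have "length b \<le> Suc v" if "bs \<in> block_words v t" "b \<in> set bs" for bs b
  proof -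
    have "distinct b" "set b \<subseteq> {0..v}" using that by (auto simp: block_words_def distinct_concat_iff)
    then show ?thesis using card_mono[of "{0..v}" "set b"] by (simp add: distinct_card)
  qed
  then have "block_words v t \<subseteq> {bs. set bs \<subseteq> ?B \<and> length bs = t}"
    by (auto simp: block_words_def)
  moreover have "finite {bs. set bs \<subseteq> ?B \<and> length bs = t}"
    by (intro finite_lists_length_eq finite_lists_length_le) simp
  ultimately show ?thesis by (rule finite_subset)
qed

section \<open>Inserting a new largest letter into block words\<close>

definition cuts :: "nat \<Rightarrow> 'a list set \<Rightarrow> ('a list \<times> 'a list) set" where
  "cuts k A = {(us, ws). us @ ws \<in> A \<and> k \<le> length ws}"

text \<open>Of the n + 1 places to cut, the last k leave fewer than k entries on the right.\<close>

lemma card_cuts: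
  assumes "\<And>xs. xs \<in> A \<Longrightarrow> length xs = n" "k \<le> Suc n"
  shows "card (cuts k A) = (Suc n - k) * card A"
proof -
  have bij: "bij_betw (\<lambda>(i, xs). (take i xs, drop i xs)) ({..<Suc n - k} \<times> A) (cuts k A)"
    by (rule bij_betwI[where g = "\<lambda>(us, ws). (length us, us @ ws)"])
      (use assms in \<open>force simp: cuts_def\<close>)+
  show ?thesis using bij_betw_same_card[OF bij] by (simp add: card_cartesian_product)
qed

lemma finite_cuts: "finite A \<Longrightarrow> finite (cuts k A)"
proof -
  assume "finite A"
  then have "finite (\<Union>xs\<in>A. (\<lambda>i. (take i xs, drop i xs)) ` {..length xs})" by simp
  moreover have "cuts k A \<subseteq> (\<Union>xs\<in>A. (\<lambda>i. (take i xs, drop i xs)) ` {..length xs})"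
  proof
    fix p assume "p \<in> cuts k A"
    then obtain us ws where "p = (us, ws)" "us @ ws \<in> A" by (auto simp: cuts_def)
    then show "p \<in> (\<Union>xs\<in>A. (\<lambda>i. (take i xs, drop i xs)) ` {..length xs})"
      by (intro UN_I[of "us @ ws"] image_eqI[of _ _ "length us"]) auto
  qed
  ultimately show ?thesis by (rule rev_finite_subset)
qed

text \<open>All three insertions produce this shape with a letter \<open>y\<close> that is new, so
  its place determines the original word; this gives injectivity and disjointness.\<close>

lemma block_split_unique:
  assumes "us @ (p @ y # q) # ws = us' @ (p' @ y # q') # ws'"
    and "y \<notin> set (concat us)" "y \<notin> set p" "y \<notin> set q" "y \<notin> set (concat us')" "y \<notin> set p'" "y \<notin> set q'"
  shows "us = us' \<and> p = p' \<and> q = q' \<and> ws = ws'"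
  using assms
proof (induction us arbitrary: us')
  case Nil
  then show ?case by (cases us') (auto simp: append_Cons_eq_iff)
next
  case (Cons u us)
  then show ?case by (cases us') (auto simp: append_Cons_eq_iff)
qed

text \<open>A new largest letter can head a block, form a block, or join two neighbouring blocks. It
  cannot end a longer block: it would have to be even after its predecessor and odd before the next
  larger letter.\<close>

definition prepend_head :: "nat \<Rightarrow> nat list list \<times> nat list list \<Rightarrow> nat list list" where
  "prepend_head y = (\<lambda>(us, ws). us @ (y # hd ws) # tl ws)"

definition insert_singleton :: "nat \<Rightarrow> nat list list \<times> nat list list \<Rightarrow> nat list list" where
  "insert_singleton y = (\<lambda>(us, ws). us @ [y] # ws)"

definition merge_blocks :: "nat \<Rightarrow> nat list list \<times> nat list list \<Rightarrow> nat list list" where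
  "merge_blocks y = (\<lambda>(us, ws). us @ (hd ws @ y # hd (tl ws)) # tl (tl ws))"

lemma cuts_1E:
  assumes "z \<in> cuts 1 A"
  obtains us b ws where "z = (us, b # ws)" "us @ b # ws \<in> A"
  using assms by (auto simp: cuts_def Suc_le_length_iff)

lemma cuts_2E:
  assumes "z \<in> cuts 2 A"
  obtains us b c ws where "z = (us, b # c # ws)" "us @ b # c # ws \<in> A"
  using assms by (auto simp: cuts_def numeral_2_eq_2 Suc_le_length_iff)

lemma block_words_notin: "bs \<in> block_words v t \<Longrightarrow> Suc v \<notin> set (concat bs)"
  by (simp add: block_words_def)

lemma inj_on_prepend_head: "inj_on (prepend_head (Suc v)) (cuts 1 (block_words v t))"
proof (rule inj_onI)
  fix z z' assume z: "z \<in> cuts 1 (block_words v t)" "z' \<in> cuts 1 (block_words v t)"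
    and eq: "prepend_head (Suc v) z = prepend_head (Suc v) z'"
  obtain us b ws where 1: "z = (us, b # ws)" "us @ b # ws \<in> block_words v t"
    using z(1) by (rule cuts_1E)
  obtain us' b' ws' where 2: "z' = (us', b' # ws')" "us' @ b' # ws' \<in> block_words v t"
    using z(2) by (rule cuts_1E)
  show "z = z'"
    using block_split_unique[of us "[]" "Suc v" b ws us' "[]" b' ws'] eq 1(1) 2(1)
      block_words_notin[OF 1(2)] block_words_notin[OF 2(2)]
    by (auto simp: prepend_head_def)
qed

lemma inj_on_insert_singleton: "inj_on (insert_singleton (Suc v)) (cuts 1 (block_words v t))"
proof (rule inj_onI)
  fix z z' assume z: "z \<in> cuts 1 (block_words v t)" "z' \<in> cuts 1 (block_words v t)"
    and eq: "insert_singleton (Suc v) z = insert_singleton (Suc v) z'"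
  obtain us b ws where 1: "z = (us, b # ws)" "us @ b # ws \<in> block_words v t"
    using z(1) by (rule cuts_1E)
  obtain us' b' ws' where 2: "z' = (us', b' # ws')" "us' @ b' # ws' \<in> block_words v t"
    using z(2) by (rule cuts_1E)
  show "z = z'"
    using block_split_unique[of us "[]" "Suc v" "[]" "b # ws" us' "[]" "[]" "b' # ws'"] eq 1(1) 2(1)
      block_words_notin[OF 1(2)] block_words_notin[OF 2(2)]
    by (auto simp: insert_singleton_def)
qed

lemma inj_on_merge_blocks: "inj_on (merge_blocks (Suc v)) (cuts 2 (block_words v t))"
proof (rule inj_onI)
  fix z z' assume z: "z \<in> cuts 2 (block_words v t)" "z' \<in> cuts 2 (block_words v t)"
    and eq: "merge_blocks (Suc v) z = merge_blocks (Suc v) z'"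
  obtain us b c ws where 1: "z = (us, b # c # ws)" "us @ b # c # ws \<in> block_words v t"
    using z(1) by (rule cuts_2E)
  obtain us' b' c' ws' where 2: "z' = (us', b' # c' # ws')" "us' @ b' # c' # ws' \<in> block_words v t"
    using z(2) by (rule cuts_2E)
  show "z = z'"
    using block_split_unique[of us b "Suc v" c ws us' b' c' ws'] eq 1(1) 2(1)
      block_words_notin[OF 1(2)] block_words_notin[OF 2(2)]
    by (auto simp: merge_blocks_def)
qed

lemma successively_ascent_ok_max:
  assumes "c \<noteq> []" "\<And>x. x \<in> set c \<Longrightarrow> x < y"
  shows "successively ascent_ok (y # c) \<longleftrightarrow> successively ascent_ok c"
  using assms(1) assms(2)[of "hd c"] by (cases c) (auto simp: ascent_ok_def)

lemma block_words_less:
  assumes "bs \<in> block_words v t" "b \<in> set bs" "x \<in> set b"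
  shows "x < Suc v"
  using assms by (auto simp: block_words_def less_Suc_eq_le)

lemma prepend_head_in: "prepend_head (Suc v) ` cuts 1 (block_words v t) \<subseteq> block_words (Suc v) t"
proof (rule image_subsetI, elim cuts_1E)
  fix z us b ws assume z: "z = (us, b # ws)" "us @ b # ws \<in> block_words v t"
  have b: "b \<noteq> []" using z(2) by (auto simp: block_words_def admissible_append)
  have "successively ascent_ok (Suc v # b) \<longleftrightarrow> successively ascent_ok b"
    by (rule successively_ascent_ok_max[OF b]) (use block_words_less[OF z(2), of b] in auto)
  then have "admissible (us @ (Suc v # b) # ws)"
    using z(2) b by (auto simp: block_words_def admissible_append split: if_splits)
  then show "prepend_head (Suc v) z \<in> block_words (Suc v) t"
    using z(2) block_words_notin[OF z(2)] unfolding z(1)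
    by (auto simp: block_words_def prepend_head_def atLeastAtMostSuc_conv)
qed

text \<open>A block is kept to the right of the cut because the last block must end in 0.\<close>

lemma insert_singleton_in:
  assumes "odd (Suc v)"
  shows "insert_singleton (Suc v) ` cuts 1 (block_words v t) \<subseteq> block_words (Suc v) (Suc t)"
proof (rule image_subsetI, elim cuts_1E)
  fix z us b ws assume z: "z = (us, b # ws)" "us @ b # ws \<in> block_words v t"
  have "admissible (us @ [Suc v] # b # ws)"
    using z(2) assms by (auto simp: block_words_def admissible_append)
  then show "insert_singleton (Suc v) z \<in> block_words (Suc v) (Suc t)"
    using z(2) block_words_notin[OF z(2)] unfolding z(1)
    by (auto simp: block_words_def insert_singleton_def atLeastAtMostSuc_conv)
qed

lemma merge_blocks_in:
  assumes "even (Suc v)"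
  shows "merge_blocks (Suc v) ` cuts 2 (block_words v (Suc t)) \<subseteq> block_words (Suc v) t"
proof (rule image_subsetI, elim cuts_2E)
  fix z us b c ws assume z: "z = (us, b # c # ws)" "us @ b # c # ws \<in> block_words v (Suc t)"
  have bc: "b \<noteq> []" "c \<noteq> []" "odd (last b)" using z(2) by (auto simp: block_words_def admissible_append)
  have "successively ascent_ok (Suc v # c) \<longleftrightarrow> successively ascent_ok c"
    by (rule successively_ascent_ok_max[OF bc(2)]) (use block_words_less[OF z(2), of c] in auto)
  then have "admissible (us @ (b @ Suc v # c) # ws)"
    using z(2) bc assms
    by (auto simp: block_words_def admissible_append successively_append_iff ascent_ok_def split: if_splits)
  then show "merge_blocks (Suc v) z \<in> block_words (Suc v) t"
    using z(2) block_words_notin[OF z(2)] unfolding z(1)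
    by (auto simp: block_words_def merge_blocks_def atLeastAtMostSuc_conv)
qed

lemma block_words_SucE:
  assumes "bs \<in> block_words (Suc v) t"
  obtains us p q ws where "bs = us @ (p @ Suc v # q) # ws"
    "set (concat us) \<union> set p \<union> set q \<union> set (concat ws) = {0..v}"
    "distinct (concat us @ p @ q @ concat ws)"
    "successively ascent_ok (p @ Suc v # q)"
    "if ws = [] then last (p @ Suc v # q) = 0 else odd (last (p @ Suc v # q)) \<and> admissible ws"
    "\<forall>b\<in>set us. b \<noteq> [] \<and> successively ascent_ok b \<and> odd (last b)"
    "t = length us + Suc (length ws)"
proof -
  have bs: "length bs = t" "admissible bs" "distinct (concat bs)" "set (concat bs) = {0..Suc v}"
    using assms by (auto simp: block_words_def)
  have "Suc v \<in> set (concat bs)" unfolding bs(4) by simp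
  then obtain b where b: "b \<in> set bs" "Suc v \<in> set b" by auto
  obtain us ws where us: "bs = us @ b # ws" using b(1) by (meson split_list)
  obtain p q where p: "b = p @ Suc v # q" using b(2) by (meson split_list)
  have notin: "Suc v \<notin> set (concat us) \<union> set p \<union> set q \<union> set (concat ws)"
    using bs(3) unfolding us p by auto
  have "insert (Suc v) (set (concat us) \<union> set p \<union> set q \<union> set (concat ws)) = insert (Suc v) {0..v}"
    using bs(4) unfolding us p by (auto simp: atLeastAtMostSuc_conv)
  then have "set (concat us) \<union> set p \<union> set q \<union> set (concat ws) = {0..v}"
    using notin by (metis atLeastAtMost_iff insert_ident not_less_eq_eq order_refl)
  moreover have "distinct (concat us @ p @ q @ concat ws)"
    using bs(3) unfolding us p by auto
  ultimately show ?thesis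
    using that[of us p q ws] bs(1,2) unfolding us p by (auto simp: admissible_append)
qed

text \<open>The parts \<open>p\<close> and \<open>q\<close> around the largest letter in its block
  decide the insertion: both empty, only \<open>p\<close> empty, or \<open>p\<close>
  nonempty.\<close>

lemma block_words_Suc_cases:
  assumes bs: "bs \<in> block_words (Suc v) t"
  shows "bs \<in> prepend_head (Suc v) ` cuts 1 (block_words v t) \<or>
    odd (Suc v) \<and> bs \<in> insert_singleton (Suc v) ` cuts 1 (block_words v (t - 1)) \<or>
    even (Suc v) \<and> bs \<in> merge_blocks (Suc v) ` cuts 2 (block_words v (Suc t))"
proof -
  from bs obtain us p q ws where eq: "bs = us @ (p @ Suc v # q) # ws"
    and set_eq: "set (concat us) \<union> set p \<union> set q \<union> set (concat ws) = {0..v}"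
    and dist: "distinct (concat us @ p @ q @ concat ws)"
    and succ: "successively ascent_ok (p @ Suc v # q)"
    and ws: "if ws = [] then last (p @ Suc v # q) = 0 else odd (last (p @ Suc v # q)) \<and> admissible ws"
    and us: "\<forall>b\<in>set us. b \<noteq> [] \<and> successively ascent_ok b \<and> odd (last b)"
    and t: "t = length us + Suc (length ws)"
    by (rule block_words_SucE)
  show ?thesis
  proof (cases "p = []")
    case p: True
    show ?thesis
    proof (cases "q = []")
      case True
      then have "ws \<noteq> []" "odd (Suc v)" using ws p by (auto split: if_splits)
      moreover have "us @ ws \<in> block_words v (t - 1)"
        using \<open>ws \<noteq> []\<close> True p set_eq dist ws us t by (auto simp: block_words_def admissible_append)
      then have "(us, ws) \<in> cuts 1 (block_words v (t - 1))"
        using \<open>ws \<noteq> []\<close> by (cases ws) (auto simp: cuts_def)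
      moreover have "bs = insert_singleton (Suc v) (us, ws)"
        using True p eq by (simp add: insert_singleton_def)
      ultimately show ?thesis by blast
    next
      case False
      then have "us @ q # ws \<in> block_words v t"
        using p set_eq dist ws us t succ
        by (auto simp: block_words_def admissible_append successively_Cons split: if_splits)
      then have "(us, q # ws) \<in> cuts 1 (block_words v t)" by (simp add: cuts_def)
      moreover have "bs = prepend_head (Suc v) (us, q # ws)"
        using p eq by (simp add: prepend_head_def)
      ultimately show ?thesis by blast
    qed
  next
    case p: False
    then have "ascent_ok (last p) (Suc v)" "successively ascent_ok p" "successively ascent_ok (Suc v # q)"
      using succ by (auto simp: successively_append_iff)
    moreover have "last p \<in> {0..v}" unfolding set_eq[symmetric] using p by simp
    ultimately have odd: "odd (last p)" "even (Suc v)" by (auto simp: ascent_ok_def)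
    \<comment> \<open>A positive even letter cannot end a block.\<close>
    then have q: "q \<noteq> []" using ws by (auto split: if_splits)
    then have "us @ p # q # ws \<in> block_words v (Suc t)"
      using p set_eq dist ws us t odd \<open>successively ascent_ok p\<close> \<open>successively ascent_ok (Suc v # q)\<close>
      by (auto simp: block_words_def admissible_append successively_Cons split: if_splits)
    then have "(us, p # q # ws) \<in> cuts 2 (block_words v (Suc t))" by (simp add: cuts_def)
    moreover have "bs = merge_blocks (Suc v) (us, p # q # ws)"
      using eq by (simp add: merge_blocks_def)
    ultimately show ?thesis using odd by blast
  qed
qed

lemma block_words_length: "bs \<in> block_words v t \<Longrightarrow> length bs = t"
  by (simp add: block_words_def)

lemma card_block_words_odd:
  assumes "odd (Suc v)"
  shows "card (block_words (Suc v) t) =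
    t * card (block_words v t) + (t - 1) * card (block_words v (t - 1))"
proof (cases t)
  case 0
  then show ?thesis by (auto simp: block_words_def)
next
  case (Suc s)
  let ?A = "prepend_head (Suc v) ` cuts 1 (block_words v t)"
  let ?B = "insert_singleton (Suc v) ` cuts 1 (block_words v s)"
  have "block_words (Suc v) t = ?A \<union> ?B"
    using block_words_Suc_cases[of _ v t] prepend_head_in[of v t] insert_singleton_in[OF assms, of s] assms Suc
    by auto
  moreover have "?A \<inter> ?B = {}"
  proof (intro equals0I, elim IntE imageE cuts_1E)
    fix bs z z' us b ws us' b' ws'
    assume *: "z = (us, b # ws)" "us @ b # ws \<in> block_words v t" "bs = prepend_head (Suc v) z"
      "z' = (us', b' # ws')" "us' @ b' # ws' \<in> block_words v s" "bs = insert_singleton (Suc v) z'"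
    have "b \<noteq> []" using *(2) by (auto simp: block_words_def admissible_append)
    moreover have "us @ ([] @ Suc v # b) # ws = us' @ ([] @ Suc v # []) # b' # ws'"
      using *(1,3,4,6) by (simp add: prepend_head_def insert_singleton_def)
    from block_split_unique[OF this] have "b = []"
      using block_words_notin[OF *(2)] block_words_notin[OF *(5)] by simp
    ultimately show False by simp
  qed
  moreover have "card ?A = t * card (block_words v t)"
    by (subst card_image[OF inj_on_prepend_head], subst card_cuts[of _ t]) (auto simp: block_words_length)
  moreover have "card ?B = s * card (block_words v s)"
    by (subst card_image[OF inj_on_insert_singleton], subst card_cuts[of _ s]) (auto simp: block_words_length)
  ultimately show ?thesis
    using Suc by (simp add: card_Un_disjoint finite_cuts finite_block_words)
qed

lemma card_block_words_even:
  assumes "even (Suc v)"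
  shows "card (block_words (Suc v) t) = t * (card (block_words v t) + card (block_words v (Suc t)))"
proof -
  let ?A = "prepend_head (Suc v) ` cuts 1 (block_words v t)"
  let ?B = "merge_blocks (Suc v) ` cuts 2 (block_words v (Suc t))"
  have "block_words (Suc v) t = ?A \<union> ?B"
    using block_words_Suc_cases[of _ v t] prepend_head_in[of v t] merge_blocks_in[OF assms, of t] assms
    by auto
  moreover have "?A \<inter> ?B = {}"
  proof (intro equals0I, elim IntE imageE cuts_1E cuts_2E)
    fix bs z z' us b ws us' b' c' ws'
    assume *: "z = (us, b # ws)" "us @ b # ws \<in> block_words v t" "bs = prepend_head (Suc v) z"
      "z' = (us', b' # c' # ws')" "us' @ b' # c' # ws' \<in> block_words v (Suc t)" "bs = merge_blocks (Suc v) z'"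
    have "b' \<noteq> []" using *(5) by (auto simp: block_words_def admissible_append)
    moreover have "us @ ([] @ Suc v # b) # ws = us' @ (b' @ Suc v # c') # ws'"
      using *(1,3,4,6) by (simp add: prepend_head_def merge_blocks_def)
    from block_split_unique[OF this] have "b' = []"
      using block_words_notin[OF *(2)] block_words_notin[OF *(5)] by simp
    ultimately show False by simp
  qed
  moreover have "card ?A = t * card (block_words v t)"
    by (subst card_image[OF inj_on_prepend_head], subst card_cuts[of _ t]) (auto simp: block_words_length)
  moreover have "card ?B = t * card (block_words v (Suc t))"
    by (subst card_image[OF inj_on_merge_blocks], subst card_cuts[of _ "Suc t"]) (auto simp: block_words_length)
  ultimately show ?thesis
    by (simp add: card_Un_disjoint finite_cuts finite_block_words algebra_simps)
qed

section \<open>Counting block words and returning to permutations\<close>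

lemma block_words_one:
  "block_words v 1 = {[w @ [0]] | w. distinct w \<and> set w = {1..v} \<and> successively ascent_ok w}"
proof (intro equalityI subsetI)
  fix bs assume "bs \<in> block_words v 1"
  then obtain b where b: "bs = [b]" "b \<noteq> []" "successively ascent_ok b" "last b = 0" "distinct b" "set b = {0..v}"
  proof -
    have "length bs = 1" using \<open>bs \<in> block_words v 1\<close> by (rule block_words_length)
    then obtain b where "bs = [b]" by (cases bs) auto
    then show ?thesis using that \<open>bs \<in> block_words v 1\<close> by (simp add: block_words_def)
  qed
  define w where "w = butlast b"
  have w: "b = w @ [0]" using b(2,4) by (metis w_def append_butlast_last_id)
  have "0 \<notin> set w" "insert 0 (set w) = {0..v}" using b(5,6) unfolding w by simp_all
  then have "set w = {0..v} - {0}" by blast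
  also have "{0..v} - {0} = {1..v}" by auto
  finally have "set w = {1..v}" .
  then show "bs \<in> {[w @ [0]] | w. distinct w \<and> set w = {1..v} \<and> successively ascent_ok w}"
    using b(1,3,5) unfolding w by (simp add: successively_append_iff)
next
  fix bs assume "bs \<in> {[w @ [0]] | w. distinct w \<and> set w = {1..v} \<and> successively ascent_ok w}"
  then obtain w where w: "bs = [w @ [0]]" "distinct w" "set w = {1..v}" "successively ascent_ok w"
    by blast
  have "successively ascent_ok (w @ [0])"
    using w(4) by (simp add: successively_append_iff ascent_ok_def)
  moreover have "insert 0 (set w) = {0..v}" unfolding w(3) by auto
  ultimately show "bs \<in> block_words v 1"
    using w(1-3) by (simp add: block_words_def)
qed

lemma card_block_words: "card (block_words (2 * n) t) = path_weight n t"
proof (induction n arbitrary: t)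
  case 0
  have "block_words 0 t = (if t = 1 then {[[0]]} else {})"
  proof (cases "t = 1")
    case True
    then show ?thesis using block_words_one[of 0] by auto
  next
    case False
    have "t = 1" if "bs \<in> block_words 0 t" for bs
    proof -
      have bs: "length bs = t" "admissible bs" "distinct (concat bs)" "set (concat bs) = {0}"
        using that by (auto simp: block_words_def)
      have "length (concat bs) = 1" using distinct_card[OF bs(3)] bs(4) by simp
      \<comment> \<open>Blocks are nonempty, so the single letter 0 allows only one block.\<close>
      moreover have "length xs \<le> length (concat xs)" if "admissible xs" for xs
        using that by (induction xs) (auto split: if_splits simp: Suc_le_eq add_strict_increasing)
      ultimately have "length bs \<le> 1" using bs(2) by metis
      moreover have "bs \<noteq> []" using bs(2) by auto
      ultimately show ?thesis using bs(1) by (cases bs) auto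
    qed
    then show ?thesis using False by auto
  qed
  then show ?case by simp
next
  case (Suc n)
  \<comment> \<open>One path step inserts two letters, the odd 2n + 1 and then the even 2n +
    2.\<close>
  have odd: "card (block_words (Suc (2 * n)) t) = t * path_weight n t + (t - 1) * path_weight n (t - 1)" for t
    by (simp add: card_block_words_odd Suc.IH)
  have "card (block_words (2 * Suc n) t) =
      t * (card (block_words (Suc (2 * n)) t) + card (block_words (Suc (2 * n)) (Suc t)))"
    using card_block_words_even[of "Suc (2 * n)" t] by simp
  also have "\<dots> = path_weight (Suc n) t"
    unfolding odd by (cases t) (simp_all add: algebra_simps power2_eq_square)
  finally show ?case .
qed

lemma card_permutation_words:
  "card {\<pi>. \<pi> permutes {1..v} \<and> P (map \<pi> [1..<Suc v])} = card {w. distinct w \<and> set w = {1..v} \<and> P w}"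
proof -
  let ?w = "\<lambda>\<pi>. map \<pi> [1..<Suc v]"
  have "bij_betw ?w {\<pi>. \<pi> permutes {1..v} \<and> P (?w \<pi>)} {w. distinct w \<and> set w = {1..v} \<and> P w}"
    unfolding bij_betw_def
  proof
    show "inj_on ?w {\<pi>. \<pi> permutes {1..v} \<and> P (?w \<pi>)}"
    proof (rule inj_onI, rule ext)
      fix \<pi> \<rho> i
      assume a: "\<pi> \<in> {\<pi>. \<pi> permutes {1..v} \<and> P (?w \<pi>)}" "\<rho> \<in> {\<pi>. \<pi> permutes {1..v} \<and> P (?w \<pi>)}"
        and eq: "?w \<pi> = ?w \<rho>"
      show "\<pi> i = \<rho> i"
      proof (cases "i \<in> {1..v}")
        case True
        then show ?thesis using eq by (simp del: upt_Suc)
      next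
        case False
        then show ?thesis using a permutes_not_in[of \<pi> "{1..v}" i] permutes_not_in[of \<rho> "{1..v}" i] by simp
      qed
    qed
    show "?w ` {\<pi>. \<pi> permutes {1..v} \<and> P (?w \<pi>)} = {w. distinct w \<and> set w = {1..v} \<and> P w}"
    proof (intro equalityI subsetI)
      fix w assume "w \<in> ?w ` {\<pi>. \<pi> permutes {1..v} \<and> P (?w \<pi>)}"
      then obtain \<pi> where \<pi>: "\<pi> permutes {1..v}" "P w" "w = ?w \<pi>" by auto
      have "set [1..<Suc v] = {1..v}" by auto
      then have "set w = {1..v}" unfolding \<pi>(3) set_map using permutes_image[OF \<pi>(1)] by simp
      moreover have "distinct w"
        unfolding \<pi>(3) distinct_map using permutes_inj_on[OF \<pi>(1)] by simp
      ultimately show "w \<in> {w. distinct w \<and> set w = {1..v} \<and> P w}" using \<pi>(2) by simp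
    next
      fix w assume "w \<in> {w. distinct w \<and> set w = {1..v} \<and> P w}"
      then have w: "distinct w" "set w = {1..v}" "P w" by auto
      have len: "length w = v" using distinct_card[OF w(1)] w(2) by simp
      define \<pi> where "\<pi> i = (if i \<in> {1..v} then w ! (i - 1) else i)" for i
      have eq: "?w \<pi> = w"
        by (rule nth_equalityI) (auto simp: len \<pi>_def simp del: upt_Suc)
      have "set [1..<Suc v] = {1..v}" by auto
      then have "inj_on \<pi> {1..v}" "\<pi> ` {1..v} = {1..v}"
        using w(1,2) unfolding eq[symmetric] distinct_map set_map by auto
      then have "\<pi> permutes {1..v}"
        by (intro bij_imp_permutes) (auto simp: bij_betw_def \<pi>_def)
      then show "w \<in> ?w ` {\<pi>. \<pi> permutes {1..v} \<and> P (?w \<pi>)}"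
        using eq w(3) by (intro image_eqI[of _ _ \<pi>]) auto
    qed
  qed
  then show ?thesis by (rule bij_betw_same_card)
qed

lemma ascents_odd_even_iff_successively:
  "ascents_odd_even v \<pi> \<longleftrightarrow> successively ascent_ok (map \<pi> [1..<Suc v])"
proof -
  have "successively ascent_ok (map \<pi> [1..<Suc v]) \<longleftrightarrow>
      (\<forall>i. Suc i < v \<longrightarrow> ascent_ok (\<pi> (Suc i)) (\<pi> (Suc (Suc i))))"
    by (simp add: successively_conv_nth del: upt_Suc)
  also have "\<dots> \<longleftrightarrow> (\<forall>i\<in>{1..<v}. ascent_ok (\<pi> i) (\<pi> (i + 1)))"
    by (auto simp: Suc_le_eq gr0_conv_Suc)
  finally show ?thesis by (simp add: ascents_odd_even_def ascent_ok_def)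
qed

lemma genocchi_I_path_weight: "genocchi_I n = path_weight n 1"
proof -
  have "genocchi_I n = card {w. distinct w \<and> set w = {1..2 * n} \<and> successively ascent_ok w}"
    unfolding genocchi_I_def ascents_odd_even_iff_successively by (rule card_permutation_words)
  also have "\<dots> = card ((\<lambda>w. [w @ [0]]) ` {w. distinct w \<and> set w = {1..2 * n} \<and> successively ascent_ok w})"
    by (rule card_image[symmetric]) (simp add: inj_on_def)
  also have "\<dots> = card (block_words (2 * n) 1)"
    unfolding block_words_one by (simp add: setcompr_eq_image)
  finally show ?thesis by (simp add: card_block_words)
qed

theorem theorem4p2:
  fixes n :: nat
  shows "num_collapsed (n + 1) = median_genocchi n \<and> median_genocchi n = genocchi_I n"
  by (simp only: num_collapsed_path_weight median_genocchi_path_weight genocchi_I_path_weight)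

end
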